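(* Let $\mathbb{X}$ be a Euclidean space, let $D\subseteq\mathbb{X}$ be nonempty and closed, and let $\varphi:\mathbb{X}\to\mathbb{R}$ be upper-$\mathcal{C}^2$ with $\inf\varphi>-\infty$. Assume there is a constant $\kappa\ge 0$ such that $$\varphi(y)\le\varphi(x)+\langle w,y-x\rangle+\kappa\|y-x\|^2\quad\text{for all }x,y\in D\text{ and all }w\in\partial\varphi(x).$$ Let $\{x^k\}$ be a sequence generated by the Auto-Conditioned Projected Subgradient Method (described in the context) given any $x^0\in D$. Then either the method stops after a finite number of iterations at a point $x^k$ with $-w^k\in N^P_D(x^k)$, or the following assertions hold for $\{x^k\}$: 1. Any accumulation point $x^*$ of $\{x^k\}$ is a proximal critical point, that is, there exists $w^*\in\partial\varphi(x^* )$ such that $-w^*\in N^P_D(x^* )$. 2. If $x^*$ is an accumulation point of $\{x^k\}$, then the sequence $\{\varphi(x^k)\}$ converges to $\varphi(x^* )$.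
   Context: $\mathbb{X}$ is a Euclidean space (finite-dimensional real Hilbert space) with inner product $\langle\cdot,\cdot\rangle$ and induced norm $\|\cdot\|$. For a nonempty closed set $D\subseteq\mathbb{X}$ (not necessarily convex), $\Pi_D(x) := \{y \in D : \|x-y\| = \inf_{z\in D}\|x-z\|\}$ is the (set-valued) projection. Upper-$\mathcal{C}^2$: a function $\varphi$ is upper-$\mathcal{C}^2$ on an open set $U\subseteq\mathbb{X}$ if each $\bar x\in U$ has a neighborhood $V$ on which $\varphi(x)=\min_{c\in C}\varphi_c(x)$, where the functions $\varphi_c$ are of class $C^2$ on $V$, $C$ is a compact set (in some topological space), and $\varphi_c$ together with its first- and second-order partial derivatives depends continuously on $(x,c)\in V\times C$. Such functions are locally Lipschitz on $U$. "Upper-$\mathcal{C}^2$" without further specification means on $\mathbb{X}$. Subdifferentials: the regular (Fréchet) subdifferential is $\partial^F\varphi(x)=\{v : \liminf_{y\to x,\,y\neq x}\frac{\varphi(y)-\varphi(x)-\langle v,y-x\rangle}{\|y-x\|}\ge 0\}$; the limiting subdifferential is $\partial^M\varphi(x)=\{v : \exists\, x^k\to x,\ \varphi(x^k)\to\varphi(x),\ v^k\to v,\ v^k\in\partial^F\varphi(x^k)\ \forall k\}$; the Clarke subdifferential is $\partial^C\varphi(x)=\{v:\langle v,h\rangle\le\varphi^\circ(x;h)\ \forall h\in\mathbb{X}\}$ with $\varphi^\circ(x;h)=\limsup_{z\to x,\,t\to0^+}\frac{\varphi(z+th)-\varphi(z)}{t}$. The symbol $\partial\varphi$ means either $\partial^M\varphi$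 or $\partial^C\varphi$ (the result holds for each of the two choices, used consistently). Proximal normal cone: $N^P_D(\bar x)=\{v\in\mathbb{X} : \exists\,\bar\tau>0,\ \bar x\in\Pi_D(\bar x+\bar\tau v)\}$ for $\bar x\in D$. Auto-Conditioned Projected Subgradient Method. Input: $x^0\in D$, $\kappa_0>0$, $\alpha>1$. For $k=0,1,2,\dots$: choose any $w^k\in\partial\varphi(x^k)$; if the termination criterion holds, stop and return $x^k$ (the termination criterion may be any criterion that is satisfied only if $-w^k\in N^P_D(x^k)$). Otherwise set $\gamma_k=\max\{\kappa_0,\dots,\kappa_k\}$ and $\tau_k=\frac{1}{2\alpha\gamma_k}$, choose $x^{k+1}\in\Pi_D(x^k-\tau_kw^k)$; if $x^{k+1}=x^k$, stop (then $-w^k\in N^P_D(x^k)$); otherwise set $$\kappa_{k+1}=\frac{\varphi(x^{k+1})-\varphi(x^k)-\langle w^k,x^{k+1}-x^k\rangle}{\|x^{k+1}-x^k\|^2}.$$ *)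

theory Defs
  imports "HOL-Analysis.Analysis"
begin

section \<open>Upper-C2 functions\<close>

definition partial_deriv :: "'a::euclidean_space \<Rightarrow> ('a \<Rightarrow> real) \<Rightarrow> 'a \<Rightarrow> real" where
  "partial_deriv b f x = deriv (\<lambda>t. f (x + t *\<^sub>R b)) 0"

(* To be used on open sets. The differentiability conditions ensure that the partial derivatives
   (which deriv makes total) really exist; conversely they hold whenever the partial derivatives
   up to order two exist and are continuous. *)
definition C2_on :: "'a::euclidean_space set \<Rightarrow> ('a \<Rightarrow> real) \<Rightarrow> bool" where
  "C2_on V f \<longleftrightarrow>
     f differentiable_on V \<and>
     (\<forall>b\<in>Basis. partial_deriv b f differentiable_on V \<and>
        (\<forall>b'\<in>Basis. continuous_on V (partial_deriv b' (partial_deriv b f))))"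

(* The index set C is compact in an arbitrary topological space T, which may depend on the point
   xbar. HOL cannot quantify over the type of the points of T inside the definition, so that type
   is the parameter 'c. A theorem that is polymorphic in 'c covers all choices of spaces: the
   spaces used at the different points all embed in one type (their disjoint sum), and the carrier
   of T need not be the whole type. *)
definition upper_C2_on ::
  "'c itself \<Rightarrow> 'a::euclidean_space set \<Rightarrow> ('a \<Rightarrow> real) \<Rightarrow> bool" where
  "upper_C2_on _ U \<phi> \<longleftrightarrow>
     (\<forall>xbar\<in>U. \<exists>V (T :: 'c topology) C F.
        open V \<and> xbar \<in> V \<and> V \<subseteq> U \<and> compactin T C \<and>
        (\<forall>x\<in>V. (\<exists>c\<in>C. \<phi> x = F c x) \<and> (\<forall>c\<in>C. \<phi> x \<le> F c x)) \<and>
        (\<forall>c\<in>C. C2_on V (F c)) \<and>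
        continuous_map (prod_topology (top_of_set V) (subtopology T C)) euclideanreal
          (\<lambda>(x, c). F c x) \<and>
        (\<forall>b\<in>Basis.
           continuous_map (prod_topology (top_of_set V) (subtopology T C)) euclideanreal
             (\<lambda>(x, c). partial_deriv b (F c) x)) \<and>
        (\<forall>b\<in>Basis. \<forall>b'\<in>Basis.
           continuous_map (prod_topology (top_of_set V) (subtopology T C)) euclideanreal
             (\<lambda>(x, c). partial_deriv b' (partial_deriv b (F c)) x)))"


section \<open>Subdifferentials\<close>

definition frechet_subdiff :: "('a::euclidean_space \<Rightarrow> real) \<Rightarrow> 'a \<Rightarrow> 'a set" where
  "frechet_subdiff \<phi> x =
     {v. Liminf (at x) (\<lambda>y. ereal ((\<phi> y - \<phi> x - v \<bullet> (y - x)) / norm (y - x))) \<ge> 0}"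

definition limiting_subdiff :: "('a::euclidean_space \<Rightarrow> real) \<Rightarrow> 'a \<Rightarrow> 'a set" where
  "limiting_subdiff \<phi> x =
     {v. \<exists>xs vs. xs \<longlonglongrightarrow> x \<and> (\<lambda>k. \<phi> (xs k)) \<longlonglongrightarrow> \<phi> x \<and> vs \<longlonglongrightarrow> v \<and>
           (\<forall>k::nat. vs k \<in> frechet_subdiff \<phi> (xs k))}"

definition clarke_dderiv :: "('a::euclidean_space \<Rightarrow> real) \<Rightarrow> 'a \<Rightarrow> 'a \<Rightarrow> ereal" where
  "clarke_dderiv \<phi> x h =
     Limsup (nhds x \<times>\<^sub>F at_right 0) (\<lambda>(z, t). ereal ((\<phi> (z + t *\<^sub>R h) - \<phi> z) / t))"

definition clarke_subdiff :: "('a::euclidean_space \<Rightarrow> real) \<Rightarrow> 'a \<Rightarrow> 'a set" where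
  "clarke_subdiff \<phi> x = {v. \<forall>h. ereal (v \<bullet> h) \<le> clarke_dderiv \<phi> x h}"


section \<open>Projections and proximal normals\<close>

definition projection :: "'a::euclidean_space set \<Rightarrow> 'a \<Rightarrow> 'a set" where
  "projection D x = {y \<in> D. norm (x - y) = (INF z\<in>D. norm (x - z))}"

definition prox_normal_cone :: "'a::euclidean_space set \<Rightarrow> 'a \<Rightarrow> 'a set" where
  "prox_normal_cone D x = {v. \<exists>\<tau>>0. x \<in> projection D (x + \<tau> *\<^sub>R v)}"


section \<open>The auto-conditioned projected subgradient method\<close>

text \<open>
  A run is given by the sequences \<open>x\<close>, \<open>w\<close>, \<open>\<kappa>\<close> and by \<open>crit\<close>, where \<open>crit k\<close> is the truth value of
  the termination criterion in iteration \<open>k\<close> of this run; the criterion itself may thus depend on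
  the whole history. Values of the sequences that the method does not compute, because it has
  stopped before, are left unconstrained.
\<close>

definition reached :: "(nat \<Rightarrow> bool) \<Rightarrow> (nat \<Rightarrow> 'a) \<Rightarrow> nat \<Rightarrow> bool" where
  "reached crit x k \<longleftrightarrow> (\<forall>j<k. \<not> crit j \<and> x (Suc j) \<noteq> x j)"

definition stops_at :: "(nat \<Rightarrow> bool) \<Rightarrow> (nat \<Rightarrow> 'a) \<Rightarrow> nat \<Rightarrow> bool" where
  "stops_at crit x k \<longleftrightarrow> reached crit x k \<and> (crit k \<or> x (Suc k) = x k)"

definition gamma :: "(nat \<Rightarrow> real) \<Rightarrow> nat \<Rightarrow> real" where
  "gamma \<kappa> k = Max (\<kappa> ` {..k})"

definition stepsize :: "real \<Rightarrow> (nat \<Rightarrow> real) \<Rightarrow> nat \<Rightarrow> real" where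
  "stepsize \<alpha> \<kappa> k = 1 / (2 * \<alpha> * gamma \<kappa> k)"

definition acpsm_run ::
  "('a::euclidean_space \<Rightarrow> 'a set) \<Rightarrow> ('a \<Rightarrow> real) \<Rightarrow> 'a set \<Rightarrow> real \<Rightarrow>
   (nat \<Rightarrow> bool) \<Rightarrow> (nat \<Rightarrow> 'a) \<Rightarrow> (nat \<Rightarrow> 'a) \<Rightarrow> (nat \<Rightarrow> real) \<Rightarrow> bool" where
  "acpsm_run S \<phi> D \<alpha> crit x w \<kappa> \<longleftrightarrow>
     x 0 \<in> D \<and> \<kappa> 0 > 0 \<and> \<alpha> > 1 \<and>
     (\<forall>k. reached crit x k \<longrightarrow>
        w k \<in> S (x k) \<and>
        (crit k \<longrightarrow> - w k \<in> prox_normal_cone D (x k)) \<and>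
        (\<not> crit k \<longrightarrow>
           x (Suc k) \<in> projection D (x k - stepsize \<alpha> \<kappa> k *\<^sub>R w k) \<and>
           (x (Suc k) \<noteq> x k \<longrightarrow>
              \<kappa> (Suc k) = (\<phi> (x (Suc k)) - \<phi> (x k) - w k \<bullet> (x (Suc k) - x k)) /
                          (norm (x (Suc k) - x k))\<^sup>2)))"

end

theory Submission
  imports Defs
begin

text \<open>
  The coefficients \<open>\<kappa> k\<close> are bounded above by \<open>max (\<kappa> 0) K\<close>, so the monotone sequence of the
  \<open>gamma \<kappa> k\<close> converges to some \<open>g > 0\<close>. Since \<open>\<alpha> > 1\<close>, eventually \<open>\<kappa> (k + 1) < \<alpha> * gamma \<kappa> k\<close> with a
  uniform gap, and from then on every step decreases \<open>\<phi>\<close> by at least a fixed multiple of the squared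
  step length. Hence \<open>\<phi> (x k)\<close> converges and the steps tend to zero. An upper-C2 function is locally
  Lipschitz, so near an accumulation point the subgradients are bounded and have a limit along a
  subsequence, and both the subdifferential and the projection have closed graphs.
\<close>

section \<open>Projections\<close>

text \<open>Distances are bounded below by 0, so for \<open>y\<close> in \<open>D\<close> equality
  with the infimum is the same as minimality. This form is easier to test against competitors and to
  pass to limits.\<close>

lemma projection_iff:
  "y \<in> projection D x \<longleftrightarrow> y \<in> D \<and> (\<forall>z\<in>D. norm (x - y) \<le> norm (x - z))"
proof -
  have bdd: "bdd_below ((\<lambda>z. norm (x - z)) ` D)"
    by (rule bdd_belowI[of _ 0]) auto
  have "norm (x - y) = (INF z\<in>D. norm (x - z)) \<longleftrightarrow> (\<forall>z\<in>D. norm (x - y) \<le> norm (x - z))"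
    if "y \<in> D"
  proof
    assume "norm (x - y) = (INF z\<in>D. norm (x - z))"
    then show "\<forall>z\<in>D. norm (x - y) \<le> norm (x - z)"
      using cINF_lower[OF bdd] by auto
  next
    assume "\<forall>z\<in>D. norm (x - y) \<le> norm (x - z)"
    then show "norm (x - y) = (INF z\<in>D. norm (x - z))"
      using that by (intro antisym cINF_greatest cINF_lower[OF bdd]) auto
  qed
  then show ?thesis
    unfolding projection_def by blast
qed

text \<open>Each competitor \<open>z\<close> gives a non-strict inequality between norms, which
  survives the limit; closedness keeps \<open>y\<close> in \<open>D\<close>.\<close>

lemma projection_closed_graph:
  assumes "closed D" "ys \<longlonglongrightarrow> y" "xs \<longlonglongrightarrow> x" "\<And>k::nat. ys k \<in> projection D (xs k)"
  shows "y \<in> projection D x"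
proof -
  have "y \<in> D"
    using assms closed_sequentially projection_iff by metis
  moreover have "norm (x - y) \<le> norm (x - z)" if "z \<in> D" for z
  proof (rule LIMSEQ_le)
    show "(\<lambda>k. norm (xs k - ys k)) \<longlonglongrightarrow> norm (x - y)"
      by (intro tendsto_intros assms)
    show "(\<lambda>k. norm (xs k - z)) \<longlonglongrightarrow> norm (x - z)"
      by (intro tendsto_intros assms)
    show "\<exists>N. \<forall>n\<ge>N. norm (xs n - ys n) \<le> norm (xs n - z)"
      using assms(4) that projection_iff by blast
  qed
  ultimately show ?thesis
    by (simp add: projection_iff)
qed

text \<open>The point \<open>u\<close> itself is a feasible competitor. Squaring and expanding the
  comparison with it cancels the square of the norm of \<open>t *\<^sub>R v\<close>.\<close>

lemma projection_step_inner:
  assumes "u \<in> D" "y \<in> projection D (u - t *\<^sub>R v)" "t > 0"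
  shows "v \<bullet> (y - u) \<le> - (norm (y - u))\<^sup>2 / (2 * t)"
proof -
  have "norm (u - t *\<^sub>R v - y) \<le> norm (u - t *\<^sub>R v - u)"
    using assms projection_iff by blast
  then have "(norm ((y - u) + t *\<^sub>R v))\<^sup>2 \<le> (norm (t *\<^sub>R v))\<^sup>2"
    by (intro power_mono) (auto simp: norm_minus_commute algebra_simps)
  then have "(norm (y - u))\<^sup>2 + 2 * t * (v \<bullet> (y - u)) \<le> 0"
    unfolding power2_norm_eq_inner
    by (simp add: inner_add_left inner_add_right inner_commute power2_eq_square algebra_simps)
  then show ?thesis
    using \<open>t > 0\<close> by (simp add: field_simps)
qed


section \<open>Upper-C2 functions are locally Lipschitz\<close>

text \<open>The chain rule along the line through \<open>x\<close> in direction \<open>b\<close>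
  identifies the \<open>deriv\<close> in \<open>partial_deriv\<close> with \<open>f' b\<close>;
  linearity does the rest.\<close>

lemma has_derivative_partial_deriv:
  assumes "(f has_derivative f') (at x)"
  shows "f' h = (\<Sum>b\<in>Basis. (h \<bullet> b) * partial_deriv b f x)"
proof -
  have *: "partial_deriv b f x = f' b" for b
  proof -
    have "((\<lambda>t::real. x + t *\<^sub>R b) has_derivative (\<lambda>t. t *\<^sub>R b)) (at 0)"
      by (auto intro!: derivative_eq_intros)
    then have "((\<lambda>t. f (x + t *\<^sub>R b)) has_derivative (\<lambda>t. f' (t *\<^sub>R b))) (at 0)"
      using has_derivative_compose[of "\<lambda>t. x + t *\<^sub>R b" _ 0 UNIV f f'] assms by simp
    moreover have "(\<lambda>t. f' (t *\<^sub>R b)) = (*) (f' b)"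
      using has_derivative_linear[OF assms] by (auto simp: linear_cmul)
    ultimately show ?thesis
      unfolding partial_deriv_def by (intro DERIV_imp_deriv) (simp add: has_field_derivative_def)
  qed
  have "f' h = f' (\<Sum>b\<in>Basis. (h \<bullet> b) *\<^sub>R b)"
    by (simp add: euclidean_representation)
  also have "\<dots> = (\<Sum>b\<in>Basis. (h \<bullet> b) * f' b)"
    using has_derivative_linear[OF assms] by (simp add: linear_sum linear_cmul)
  finally show ?thesis
    by (simp add: *)
qed

text \<open>Mean value inequality on a convex set. The constant is crude, but it depends only on the
  dimension and \<open>M\<close>, hence is uniform over a family of functions.\<close>

lemma lipschitz_on_bounded_partial_deriv:
  fixes f :: "'a::euclidean_space \<Rightarrow> real" and M :: real
  assumes "f differentiable_on V" "open V" "S \<subseteq> V" "convex S" "M \<ge> 0"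
    and bound: "\<And>z b. z \<in> S \<Longrightarrow> b \<in> Basis \<Longrightarrow> \<bar>partial_deriv b f z\<bar> \<le> M"
  shows "(DIM('a) * M)-lipschitz_on S f"
proof (rule bounded_derivative_imp_lipschitz)
  fix z assume z: "z \<in> S"
  then have "f differentiable (at z)"
    using assms(1-3) differentiable_on_eq_differentiable_at by blast
  then have D: "(f has_derivative frechet_derivative f (at z)) (at z)"
    by (simp add: frechet_derivative_works)
  then show "(f has_derivative frechet_derivative f (at z)) (at z within S)"
    by (rule has_derivative_at_withinI)
  have "norm (frechet_derivative f (at z) h) \<le> DIM('a) * M * norm h" for h
  proof -
    have "norm (frechet_derivative f (at z) h) \<le> (\<Sum>b\<in>(Basis::'a set). M * norm h)"
      unfolding has_derivative_partial_deriv[OF D]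
    proof (rule sum_norm_le)
      fix b :: 'a assume "b \<in> Basis"
      then have "\<bar>h \<bullet> b\<bar> * \<bar>partial_deriv b f z\<bar> \<le> norm h * M"
        by (intro mult_mono Basis_le_norm bound z) auto
      then show "norm ((h \<bullet> b) * partial_deriv b f z) \<le> M * norm h"
        by (simp add: abs_mult mult.commute)
    qed
    then show ?thesis by simp
  qed
  then show "onorm (frechet_derivative f (at z)) \<le> DIM('a) * M"
    by (rule onorm_le)
qed (use assms in auto)

text \<open>A pointwise minimum of functions with a common Lipschitz constant has that constant too.
  Compactness of ball times index set makes the constant common.\<close>

lemma upper_C2_on_locally_lipschitz:
  fixes \<phi> :: "'a::euclidean_space \<Rightarrow> real"
  assumes "upper_C2_on TYPE('c) U \<phi>" "u \<in> U"
  obtains e L where "e > 0" "L-lipschitz_on (ball u e) \<phi>"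
proof -
  obtain V and T :: "'c topology" and C F where V: "open V" "u \<in> V"
    and C: "compactin T C"
    and min: "\<forall>x\<in>V. (\<exists>c\<in>C. \<phi> x = F c x) \<and> (\<forall>c\<in>C. \<phi> x \<le> F c x)"
    and C2: "\<forall>c\<in>C. C2_on V (F c)"
    and cont: "\<forall>b\<in>Basis.
      continuous_map (prod_topology (top_of_set V) (subtopology T C)) euclideanreal
        (\<lambda>(x, c). partial_deriv b (F c) x)"
    using bspec[OF assms(1)[unfolded upper_C2_on_def] assms(2)]
    by (elim exE conjE) (rule that; assumption)
  obtain e where e: "e > 0" "cball u e \<subseteq> V"
    using V open_contains_cball by blast
  \<comment> \<open>The closed ball is taken for this compactness; the Lipschitz estimates below are
    on the open ball.\<close>
  have cpt: "compactin (prod_topology (top_of_set V) (subtopology T C)) (cball u e \<times> C)"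
    using C e by (simp add: compactin_Times compactin_subtopology)
  have "bounded ((\<lambda>(x, c). partial_deriv b (F c) x) ` (cball u e \<times> C))" if "b \<in> Basis" for b
    by (rule compact_imp_bounded)
      (rule image_compactin[OF cpt bspec[OF cont that], unfolded compactin_euclidean_iff])
  then have "bounded (\<Union>b\<in>Basis. (\<lambda>(x, c). partial_deriv b (F c) x) ` (cball u e \<times> C))"
    by (intro bounded_UN) auto
  then obtain M where M: "M > 0"
    "\<forall>y\<in>(\<Union>b\<in>Basis. (\<lambda>(x, c). partial_deriv b (F c) x) ` (cball u e \<times> C)). norm y \<le> M"
    unfolding bounded_pos by blast
  have F: "(DIM('a) * M)-lipschitz_on (ball u e) (F c)" if "c \<in> C" for c
  proof (rule lipschitz_on_bounded_partial_deriv)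
    show "F c differentiable_on V"
      using C2 that by (simp add: C2_on_def)
    show "\<bar>partial_deriv b (F c) z\<bar> \<le> M" if "z \<in> ball u e" "b \<in> Basis" for z b
    proof -
      have "(z, c) \<in> cball u e \<times> C"
        using that \<open>c \<in> C\<close> by auto
      then show ?thesis
        using M(2) that(2) by fastforce
    qed
  qed (use V e M ball_subset_cball in auto)
  have le: "\<phi> y - \<phi> z \<le> DIM('a) * M * dist y z" if "y \<in> ball u e" "z \<in> ball u e" for y z
  proof -
    have "y \<in> V" "z \<in> V"
      using that e ball_subset_cball by blast+
    \<comment> \<open>With \<open>c\<close> active at \<open>z\<close>, \<open>\<phi>\<close> equals
      \<open>F c\<close> at \<open>z\<close> and lies below it at \<open>y\<close>, so the bound for
      this single function suffices. Exchanging \<open>y\<close> and \<open>z\<close> gives the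
      other direction.\<close>
    then obtain c where c: "c \<in> C" "\<phi> z = F c z"
      using min by blast
    moreover have "F c y - F c z \<le> DIM('a) * M * dist y z"
      using lipschitz_onD[OF F[OF c(1)] that] by (simp add: dist_real_def)
    ultimately show ?thesis
      using min \<open>y \<in> V\<close> by fastforce
  qed
  have "(DIM('a) * M)-lipschitz_on (ball u e) \<phi>"
  proof (rule lipschitz_onI)
    show "dist (\<phi> y) (\<phi> z) \<le> DIM('a) * M * dist y z" if "y \<in> ball u e" "z \<in> ball u e" for y z
      using le[OF that] le[OF that(2,1)] by (simp add: dist_real_def dist_commute abs_le_iff)
  qed (use M in simp)
  with e(1) show thesis
    by (rule that)
qed


section \<open>Subdifferentials\<close>

text \<open>Moving from \<open>u\<close> in the direction \<open>v\<close> would make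
  \<open>\<phi>\<close> grow faster than the rate \<open>L\<close> if \<open>norm v\<close> exceeded
  \<open>L\<close>.\<close>

lemma norm_frechet_subdiff_le:
  assumes "open S" "u \<in> S" "L-lipschitz_on S \<phi>" "v \<in> frechet_subdiff \<phi> u"
  shows "norm v \<le> L"
proof (rule ccontr)
  assume "\<not> norm v \<le> L"
  then have v: "norm v > L" "L \<ge> 0" "v \<noteq> 0"
    using lipschitz_on_nonneg[OF assms(3)] by auto
  \<comment> \<open>The level \<open>L - norm v\<close> is negative, hence strictly below the
    Liminf, and along the ray it yields growth of more than \<open>L * (t * norm v)\<close>.\<close>
  have "ereal (L - norm v) < Liminf (at u) (\<lambda>y. ereal ((\<phi> y - \<phi> u - v \<bullet> (y - u)) / norm (y - u)))"
    by (rule less_le_trans[of _ 0]) (use assms(4) v in \<open>auto simp: frechet_subdiff_def\<close>)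
  then have "\<forall>\<^sub>F y in at u. L - norm v < (\<phi> y - \<phi> u - v \<bullet> (y - u)) / norm (y - u)"
    by (auto dest: less_LiminfD)
  moreover have "\<forall>\<^sub>F y in at u. y \<in> S"
    using assms eventually_at_topological by blast
  \<comment> \<open>The filter \<open>at u\<close> excludes \<open>u\<close>; the ray avoids it
    because \<open>v\<close> is nonzero.\<close>
  moreover have "filterlim (\<lambda>t. u + t *\<^sub>R v) (at u) (at_right 0)"
  proof (rule filterlim_atI)
    show "((\<lambda>t. u + t *\<^sub>R v) \<longlongrightarrow> u) (at_right 0)"
      by (auto intro!: tendsto_eq_intros)
    show "\<forall>\<^sub>F t in at_right 0. u + t *\<^sub>R v \<noteq> u"
      using v(3) by (auto simp: eventually_at_filter)
  qed
  ultimately have "\<forall>\<^sub>F t in at_right 0. u + t *\<^sub>R v \<in> S \<and>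
      L - norm v < (\<phi> (u + t *\<^sub>R v) - \<phi> u - v \<bullet> (t *\<^sub>R v)) / norm (t *\<^sub>R v)"
    by (auto simp: filterlim_iff eventually_conj_iff)
  then have "\<forall>\<^sub>F t in at_right (0::real). t > 0 \<and> u + t *\<^sub>R v \<in> S \<and>
      L - norm v < (\<phi> (u + t *\<^sub>R v) - \<phi> u - v \<bullet> (t *\<^sub>R v)) / norm (t *\<^sub>R v)"
    using eventually_at_right_less[of "0::real"] by eventually_elim auto
  then obtain t where t: "t > 0" "u + t *\<^sub>R v \<in> S"
    "L - norm v < (\<phi> (u + t *\<^sub>R v) - \<phi> u - v \<bullet> (t *\<^sub>R v)) / norm (t *\<^sub>R v)"
    using eventually_happens'[OF trivial_limit_at_right_real] by blast
  have "(L - norm v) * (t * norm v) < \<phi> (u + t *\<^sub>R v) - \<phi> u - t * (norm v * norm v)"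
    using t v by (simp add: pos_less_divide_eq power2_norm_eq_inner[symmetric] power2_eq_square)
  moreover have "\<phi> (u + t *\<^sub>R v) - \<phi> u \<le> L * (t * norm v)"
    using lipschitz_onD[OF assms(3) t(2) assms(2)] t(1) by (simp add: dist_norm)
  ultimately show False
    by (simp add: algebra_simps)
qed

text \<open>The approximating points eventually lie in the open set \<open>S\<close>, where the
  Frechet bound holds with the same \<open>L\<close>.\<close>

lemma norm_limiting_subdiff_le:
  assumes "open S" "u \<in> S" "L-lipschitz_on S \<phi>" "v \<in> limiting_subdiff \<phi> u"
  shows "norm v \<le> L"
proof -
  obtain xs vs where xs: "xs \<longlonglongrightarrow> u" "vs \<longlonglongrightarrow> v" "\<And>k::nat. vs k \<in> frechet_subdiff \<phi> (xs k)"
    using assms(4) unfolding limiting_subdiff_def by blast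
  have "\<forall>\<^sub>F k in sequentially. xs k \<in> S"
    using xs(1) assms(1,2) topological_tendstoD by blast
  then have "\<forall>\<^sub>F k in sequentially. norm (vs k) \<le> L"
    by eventually_elim (use norm_frechet_subdiff_le assms(1,3) xs(3) in blast)
  then show ?thesis
    using tendsto_upperbound[OF tendsto_norm[OF xs(2)]] by simp
qed

text \<open>A neighbourhood of \<open>u\<close> contains an open one, which is a neighbourhood of
  each of its points; the condition on \<open>t\<close> does not involve the base point.\<close>

lemma eventually_clarke_quotient_nhds:
  fixes Q :: "'a::topological_space \<times> real \<Rightarrow> bool"
  assumes "\<forall>\<^sub>F p in nhds u \<times>\<^sub>F at_right 0. Q p"
  obtains S where "open S" "u \<in> S" "\<And>y. y \<in> S \<Longrightarrow> \<forall>\<^sub>F p in nhds y \<times>\<^sub>F at_right 0. Q p"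
proof -
  obtain P R where P: "eventually P (nhds u)" and R: "eventually R (at_right 0)"
    and Q: "\<And>y t. P y \<Longrightarrow> R t \<Longrightarrow> Q (y, t)"
    using assms unfolding eventually_prod_filter by blast
  obtain S where S: "open S" "u \<in> S" "\<And>y. y \<in> S \<Longrightarrow> P y"
    using P unfolding eventually_nhds by blast
  have "\<forall>\<^sub>F p in nhds y \<times>\<^sub>F at_right 0. Q p" if "y \<in> S" for y
  proof -
    have "eventually P (nhds y)"
      using S that eventually_nhds by blast
    then show ?thesis
      unfolding eventually_prod_filter using R Q by blast
  qed
  with S show thesis
    using that by blast
qed

text \<open>Upper semicontinuity of the Clarke derivative in the base point.\<close>

lemma clarke_dderiv_upper:
  assumes "clarke_dderiv \<phi> u h < ereal c"
  obtains S where "open S" "u \<in> S" "\<And>y. y \<in> S \<Longrightarrow> clarke_dderiv \<phi> y h \<le> ereal c"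
proof -
  have "\<forall>\<^sub>F p in nhds u \<times>\<^sub>F at_right 0.
      (\<lambda>(z, t). ereal ((\<phi> (z + t *\<^sub>R h) - \<phi> z) / t)) p < ereal c"
    using assms unfolding clarke_dderiv_def by (rule Limsup_lessD)
  then obtain S where S: "open S" "u \<in> S" "\<And>y. y \<in> S \<Longrightarrow> \<forall>\<^sub>F p in nhds y \<times>\<^sub>F at_right 0.
      (\<lambda>(z, t). ereal ((\<phi> (z + t *\<^sub>R h) - \<phi> z) / t)) p < ereal c"
    using eventually_clarke_quotient_nhds by (metis (lifting))
  have "clarke_dderiv \<phi> y h \<le> ereal c" if "y \<in> S" for y
    unfolding clarke_dderiv_def
    by (rule Limsup_bounded, rule eventually_mono[OF S(3)[OF that]]) simp
  with S(1,2) show thesis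
    using that by blast
qed

text \<open>Testing the defining inequality with \<open>h = v\<close> bounds
  \<open>v \<bullet> v\<close> by \<open>L * norm v\<close>.\<close>

lemma norm_clarke_subdiff_le:
  assumes "open S" "u \<in> S" "L-lipschitz_on S \<phi>" "v \<in> clarke_subdiff \<phi> u"
  shows "norm v \<le> L"
proof -
  \<comment> \<open>The Lipschitz estimate needs both \<open>z\<close> and the shifted point in
    \<open>S\<close>.\<close>
  have "((\<lambda>p. fst p + snd p *\<^sub>R v) \<longlongrightarrow> u + 0 *\<^sub>R v) (nhds u \<times>\<^sub>F at_right 0)"
    by (intro tendsto_intros filterlim_fst filterlim_mono[OF filterlim_snd at_within_le_nhds order_refl])
  then have "\<forall>\<^sub>F p in nhds u \<times>\<^sub>F at_right 0. fst p + snd p *\<^sub>R v \<in> S"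
    using assms(1,2) topological_tendstoD by fastforce
  moreover have "\<forall>\<^sub>F p in nhds u \<times>\<^sub>F at_right (0::real). fst p \<in> S \<and> snd p > 0"
    using assms(1,2) eventually_at_right_less[of "0::real"]
    by (intro eventually_prodI eventually_nhds_in_open)
  ultimately have "\<forall>\<^sub>F p in nhds u \<times>\<^sub>F at_right 0.
      (\<lambda>(z, t). ereal ((\<phi> (z + t *\<^sub>R v) - \<phi> z) / t)) p \<le> ereal (L * norm v)"
  proof eventually_elim
    case (elim p)
    then have "\<phi> (fst p + snd p *\<^sub>R v) - \<phi> (fst p) \<le> L * (snd p * norm v)"
      using lipschitz_onD[OF assms(3), of "fst p + snd p *\<^sub>R v" "fst p"] by (simp add: dist_norm)
    then show ?case
      using elim by (simp add: case_prod_beta field_simps)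
  qed
  then have "clarke_dderiv \<phi> u v \<le> ereal (L * norm v)"
    unfolding clarke_dderiv_def by (rule Limsup_bounded)
  moreover have "ereal (v \<bullet> v) \<le> clarke_dderiv \<phi> u v"
    using assms(4) by (simp add: clarke_subdiff_def)
  ultimately have "v \<bullet> v \<le> L * norm v"
    using order_trans by fastforce
  then have "norm v * norm v \<le> L * norm v"
    by (simp add: power2_norm_eq_inner[symmetric] power2_eq_square)
  then show ?thesis
    using lipschitz_on_nonneg[OF assms(3)] by (cases "v = 0") auto
qed

lemma clarke_subdiff_closed_graph:
  assumes "xs \<longlonglongrightarrow> u" "vs \<longlonglongrightarrow> v" "\<And>k::nat. vs k \<in> clarke_subdiff \<phi> (xs k)"
  shows "v \<in> clarke_subdiff \<phi> u"
proof -
  have "ereal (v \<bullet> h) \<le> clarke_dderiv \<phi> u h" for h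
  proof (rule ccontr)
    assume "\<not> ereal (v \<bullet> h) \<le> clarke_dderiv \<phi> u h"
    \<comment> \<open>A real level strictly in between: semicontinuity keeps
      \<open>vs k \<bullet> h\<close> at most \<open>c\<close> eventually, while its limit exceeds
      \<open>c\<close>.\<close>
    then obtain c where c: "clarke_dderiv \<phi> u h < ereal c" "c < v \<bullet> h"
      using ereal_dense2 by (metis less_ereal.simps(1) not_le)
    then obtain S where S: "open S" "u \<in> S" "\<And>y. y \<in> S \<Longrightarrow> clarke_dderiv \<phi> y h \<le> ereal c"
      using clarke_dderiv_upper by blast
    have "\<forall>\<^sub>F k in sequentially. xs k \<in> S"
      using assms(1) S topological_tendstoD by blast
    then have "\<forall>\<^sub>F k in sequentially. vs k \<bullet> h \<le> c"
    proof eventually_elim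
      case (elim k)
      have "ereal (vs k \<bullet> h) \<le> clarke_dderiv \<phi> (xs k) h"
        using assms(3) by (simp add: clarke_subdiff_def)
      also have "\<dots> \<le> ereal c"
        using S(3) elim by blast
      finally show ?case by simp
    qed
    moreover have "(\<lambda>k. vs k \<bullet> h) \<longlonglongrightarrow> v \<bullet> h"
      by (intro tendsto_intros assms)
    ultimately have "v \<bullet> h \<le> c"
      using tendsto_upperbound by fastforce
    with c show False by simp
  qed
  then show ?thesis
    by (simp add: clarke_subdiff_def)
qed

lemma limiting_subdiff_approx:
  assumes "v \<in> limiting_subdiff \<phi> u" "e > 0"
  shows "\<exists>y q. q \<in> frechet_subdiff \<phi> y \<and> dist y u < e \<and> dist (\<phi> y) (\<phi> u) < e \<and> dist q v < e"
proof -
  obtain xs vs where "xs \<longlonglongrightarrow> u" "(\<lambda>k. \<phi> (xs k)) \<longlonglongrightarrow> \<phi> u" "vs \<longlonglongrightarrow> v"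
    and vs: "\<And>k::nat. vs k \<in> frechet_subdiff \<phi> (xs k)"
    using assms(1) unfolding limiting_subdiff_def by blast
  then have "\<forall>\<^sub>F k in sequentially.
      dist (xs k) u < e \<and> dist (\<phi> (xs k)) (\<phi> u) < e \<and> dist (vs k) v < e"
    using assms(2) by (intro eventually_conj tendstoD)
  then obtain k where "dist (xs k) u < e \<and> dist (\<phi> (xs k)) (\<phi> u) < e \<and> dist (vs k) v < e"
    using eventually_happens'[OF sequentially_bot] by blast
  then show ?thesis
    using vs by blast
qed

text \<open>Diagonal argument: for each \<open>k\<close> one Frechet subgradient within
  \<open>1/(k+1)\<close> of the \<open>k\<close>-th point, value and limiting subgradient.\<close>

lemma limiting_subdiff_closed_graph:
  assumes "xs \<longlonglongrightarrow> u" "(\<lambda>k. \<phi> (xs k)) \<longlonglongrightarrow> \<phi> u" "vs \<longlonglongrightarrow> v"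
    and "\<And>k::nat. vs k \<in> limiting_subdiff \<phi> (xs k)"
  shows "v \<in> limiting_subdiff \<phi> u"
proof -
  have "\<forall>k. \<exists>y q. q \<in> frechet_subdiff \<phi> y \<and> dist y (xs k) < inverse (real (Suc k)) \<and>
      dist (\<phi> y) (\<phi> (xs k)) < inverse (real (Suc k)) \<and> dist q (vs k) < inverse (real (Suc k))"
    by (intro allI limiting_subdiff_approx assms(4)) simp
  then obtain ys qs where q: "\<And>k. qs k \<in> frechet_subdiff \<phi> (ys k)"
    and near: "\<And>k. dist (ys k) (xs k) < inverse (real (Suc k))"
      "\<And>k. dist (\<phi> (ys k)) (\<phi> (xs k)) < inverse (real (Suc k))"
      "\<And>k. dist (qs k) (vs k) < inverse (real (Suc k))"
    by metis
  \<comment> \<open>Stated for a general normed space, since it serves the points, the real values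
    and the subgradients.\<close>
  have lim: "as \<longlonglongrightarrow> l" if "bs \<longlonglongrightarrow> l" "\<And>k. dist (as k) (bs k) < inverse (real (Suc k))"
    for as bs :: "nat \<Rightarrow> 'z::real_normed_vector" and l
  proof (rule Lim_transform[OF that(1)])
    show "(\<lambda>k. as k - bs k) \<longlonglongrightarrow> 0"
      using that(2) by (intro Lim_null_comparison[OF _ LIMSEQ_inverse_real_of_nat])
        (auto simp: dist_norm intro!: always_eventually less_imp_le)
  qed
  show ?thesis
    unfolding limiting_subdiff_def mem_Collect_eq
    using lim[OF assms(1) near(1)] lim[OF assms(2) near(2)] lim[OF assms(3) near(3)] q by blast
qed


section \<open>The auto-conditioned projected subgradient method\<close>

lemma kappa_le_gamma: "i \<le> k \<Longrightarrow> \<kappa> i \<le> gamma \<kappa> k"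
  unfolding gamma_def by (rule Max_ge) auto

lemma incseq_gamma: "incseq (gamma \<kappa>)"
  unfolding gamma_def by (intro monoI Max_mono) auto

lemma gamma_le: "(\<And>i. i \<le> k \<Longrightarrow> \<kappa> i \<le> B) \<Longrightarrow> gamma \<kappa> k \<le> B"
  unfolding gamma_def by (intro Max.boundedI) auto

text \<open>The initial \<open>\<kappa> 0\<close> is a free input and need not be below
  \<open>K\<close>, hence the bound \<open>max (\<kappa> 0) K\<close> for the increasing
  sequence.\<close>

lemma gamma_convergent:
  assumes "\<And>k. \<kappa> (Suc k) \<le> K"
  obtains g where "gamma \<kappa> \<longlonglongrightarrow> g" "\<And>k. gamma \<kappa> k \<le> g"
proof -
  have "\<kappa> i \<le> max (\<kappa> 0) K" for i
    using assms by (cases i) (auto simp: le_max_iff_disj)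
  then have "\<forall>k. gamma \<kappa> k \<le> max (\<kappa> 0) K"
    using gamma_le by blast
  then show thesis
    using incseq_convergent[OF incseq_gamma] that by metis
qed

text \<open>Later \<open>\<kappa> k\<close> may be negative, but the maximum always includes
  \<open>\<kappa> 0\<close>.\<close>

lemma stepsize_pos:
  assumes "\<kappa> 0 > 0" "\<alpha> > 1"
  shows "stepsize \<alpha> \<kappa> k > 0"
  using assms kappa_le_gamma[of 0 k \<kappa>] by (simp add: stepsize_def)

lemma eventually_decseq_convergent:
  fixes f :: "nat \<Rightarrow> real"
  assumes "\<forall>\<^sub>F k in sequentially. f (Suc k) \<le> f k" "bdd_below (range f)"
  obtains l where "f \<longlonglongrightarrow> l"
proof -
  obtain N where "\<And>k. k \<ge> N \<Longrightarrow> f (Suc k) \<le> f k"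
    using assms(1) unfolding eventually_sequentially by blast
  then have "decseq (\<lambda>k. f (k + N))"
    by (intro decseq_SucI) simp
  moreover obtain B where "\<And>k. B \<le> f k"
    using assms(2) unfolding bdd_below_def by blast
  ultimately obtain l where "(\<lambda>k. f (k + N)) \<longlonglongrightarrow> l"
    using decseq_convergent by metis
  then show thesis
    using LIMSEQ_offset that by blast
qed

section \<open>Finite and infinite runs\<close>

text \<open>If the run stops because the iterate repeats, the projection inclusion itself witnesses
  the proximal normal, with the step size as \<open>\<tau>\<close>.\<close>

lemma acpsm_run_stops:
  assumes "acpsm_run S \<phi> D \<alpha> crit x w \<kappa>" "stops_at crit x k"
  shows "- w k \<in> prox_normal_cone D (x k)"
proof (cases "crit k")
  case True
  then show ?thesis
    using assms unfolding acpsm_run_def stops_at_def by blast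
next
  case False
  then have "x k \<in> projection D (x k + stepsize \<alpha> \<kappa> k *\<^sub>R (- w k))"
    using assms unfolding acpsm_run_def stops_at_def by (metis add_uminus_conv_diff scaleR_minus_right)
  moreover have "stepsize \<alpha> \<kappa> k > 0"
    using assms stepsize_pos unfolding acpsm_run_def by blast
  ultimately show ?thesis
    unfolding prox_normal_cone_def by blast
qed

lemma reached_if_never_stops:
  assumes "\<And>k. \<not> stops_at crit x k"
  shows "reached crit x k"
proof (induction k)
  case (Suc k)
  then show ?case
    using assms[of k] unfolding reached_def stops_at_def by (auto simp: less_Suc_eq)
qed (simp add: reached_def)

text \<open>Without a stop every index is reached, so the rules of the run hold unconditionally. The
  last fact is the formula for \<open>\<kappa> (Suc k)\<close> with the nonzero denominator
  cleared.\<close>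

lemma acpsm_run_infinite:
  assumes "acpsm_run S \<phi> D \<alpha> crit x w \<kappa>" "\<And>k. \<not> stops_at crit x k"
  shows "x k \<in> D" "x (Suc k) \<noteq> x k" "w k \<in> S (x k)"
    "x (Suc k) \<in> projection D (x k - stepsize \<alpha> \<kappa> k *\<^sub>R w k)"
    "\<kappa> (Suc k) * (norm (x (Suc k) - x k))\<^sup>2 = \<phi> (x (Suc k)) - \<phi> (x k) - w k \<bullet> (x (Suc k) - x k)"
proof -
  have run: "\<not> crit k" "x (Suc k) \<noteq> x k" "w k \<in> S (x k)"
    "x (Suc k) \<in> projection D (x k - stepsize \<alpha> \<kappa> k *\<^sub>R w k)"
    "\<kappa> (Suc k) = (\<phi> (x (Suc k)) - \<phi> (x k) - w k \<bullet> (x (Suc k) - x k)) / (norm (x (Suc k) - x k))\<^sup>2"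
    for k
    using assms reached_if_never_stops[OF assms(2)] unfolding acpsm_run_def stops_at_def by auto
  show "x (Suc k) \<noteq> x k" "w k \<in> S (x k)"
    "x (Suc k) \<in> projection D (x k - stepsize \<alpha> \<kappa> k *\<^sub>R w k)"
    using run by auto
  show "x k \<in> D"
    using assms(1) run(4)[of "k - 1"] projection_iff unfolding acpsm_run_def by (cases k) auto
  show "\<kappa> (Suc k) * (norm (x (Suc k) - x k))\<^sup>2 =
      \<phi> (x (Suc k)) - \<phi> (x k) - w k \<bullet> (x (Suc k) - x k)"
    using run(2)[of k] by (simp add: run(5))
qed

text \<open>By the choice of \<open>\<kappa> (Suc k)\<close> the quadratic model is exact at the new
  iterate; the projection inequality bounds its linear term. The coefficient of the squared step may
  still be negative for early \<open>k\<close>.\<close>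

lemma acpsm_run_descent:
  assumes "acpsm_run S \<phi> D \<alpha> crit x w \<kappa>" "\<And>k. \<not> stops_at crit x k"
  shows "\<phi> (x (Suc k)) \<le> \<phi> (x k) - (\<alpha> * gamma \<kappa> k - \<kappa> (Suc k)) * (norm (x (Suc k) - x k))\<^sup>2"
proof -
  note run = acpsm_run_infinite[OF assms, of k]
  have pos: "stepsize \<alpha> \<kappa> k > 0"
    using assms(1) stepsize_pos unfolding acpsm_run_def by blast
  have "w k \<bullet> (x (Suc k) - x k) \<le> - (norm (x (Suc k) - x k))\<^sup>2 / (2 * stepsize \<alpha> \<kappa> k)"
    by (rule projection_step_inner[OF run(1,4) pos])
  also have "\<dots> = - (\<alpha> * gamma \<kappa> k * (norm (x (Suc k) - x k))\<^sup>2)"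
    by (simp add: stepsize_def)
  finally show ?thesis
    using run(5) by (simp add: algebra_simps)
qed

lemma acpsm_run_limits:
  assumes "acpsm_run S \<phi> D \<alpha> crit x w \<kappa>" "\<And>k. \<not> stops_at crit x k" "bdd_below (range \<phi>)"
    and "\<And>u y v. u \<in> D \<Longrightarrow> y \<in> D \<Longrightarrow> v \<in> S u \<Longrightarrow> \<phi> y \<le> \<phi> u + v \<bullet> (y - u) + K * (norm (y - u))\<^sup>2"
  obtains g l where "gamma \<kappa> \<longlonglongrightarrow> g" "g > 0" "(\<lambda>k. \<phi> (x k)) \<longlonglongrightarrow> l"
    "(\<lambda>k. x (Suc k) - x k) \<longlonglongrightarrow> 0"
proof -
  note run = acpsm_run_infinite[OF assms(1,2)]
  have \<alpha>: "\<alpha> > 1" and \<kappa>0: "\<kappa> 0 > 0"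
    using assms(1) unfolding acpsm_run_def by auto
  have "\<kappa> (Suc k) \<le> K" for k
  proof -
    have "\<kappa> (Suc k) * (norm (x (Suc k) - x k))\<^sup>2 \<le> K * (norm (x (Suc k) - x k))\<^sup>2"
      using assms(4)[OF run(1) run(1) run(3), of "Suc k" k] run(5)[of k] by simp
    then show ?thesis
      using run(2)[of k] by simp
  qed
  then obtain g where g: "gamma \<kappa> \<longlonglongrightarrow> g" "\<And>k. gamma \<kappa> k \<le> g"
    using gamma_convergent by blast
  have "g > 0"
    using g(2)[of 0] \<kappa>0 kappa_le_gamma[of 0 0 \<kappa>] by simp
  \<comment> \<open>Half the gap between \<open>\<alpha> * g\<close> and \<open>g\<close>:
    eventually \<open>\<alpha> * gamma \<kappa> k\<close> exceeds \<open>g + c\<close>.\<close>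
  define c where "c = (\<alpha> * g - g) / 2"
  have "c > 0"
    using \<open>g > 0\<close> \<alpha> by (simp add: c_def)
  have "(\<lambda>k. \<alpha> * gamma \<kappa> k) \<longlonglongrightarrow> \<alpha> * g"
    by (intro tendsto_intros g)
  moreover have "g + c < \<alpha> * g"
    using \<open>c > 0\<close> by (simp add: c_def field_simps)
  ultimately have "\<forall>\<^sub>F k in sequentially. \<alpha> * gamma \<kappa> k > g + c"
    by (rule order_tendstoD)
  then have descent: "\<forall>\<^sub>F k in sequentially. c * (norm (x (Suc k) - x k))\<^sup>2 \<le> \<phi> (x k) - \<phi> (x (Suc k))"
  proof eventually_elim
    case (elim k)
    \<comment> \<open>\<open>\<kappa> (Suc k)\<close> enters the maximum only at index
      \<open>Suc k\<close>, so it is compared with the limit \<open>g\<close> and not with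
      \<open>gamma \<kappa> k\<close>.\<close>
    have "\<kappa> (Suc k) \<le> g"
      using kappa_le_gamma[of "Suc k" "Suc k" \<kappa>] g(2)[of "Suc k"] by simp
    then have "c * (norm (x (Suc k) - x k))\<^sup>2 \<le>
        (\<alpha> * gamma \<kappa> k - \<kappa> (Suc k)) * (norm (x (Suc k) - x k))\<^sup>2"
      using elim by (intro mult_right_mono) auto
    then show ?case
      using acpsm_run_descent[OF assms(1,2), of k] by simp
  qed
  then have "\<forall>\<^sub>F k in sequentially. \<phi> (x (Suc k)) \<le> \<phi> (x k)"
  proof eventually_elim
    case (elim k)
    moreover have "0 \<le> c * (norm (x (Suc k) - x k))\<^sup>2"
      using \<open>c > 0\<close> by simp
    ultimately show ?case by linarith
  qed
  moreover have "bdd_below (range (\<lambda>k. \<phi> (x k)))"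
    using assms(3) by (rule bdd_below_mono) auto
  ultimately obtain l where l: "(\<lambda>k. \<phi> (x k)) \<longlonglongrightarrow> l"
    by (rule eventually_decseq_convergent)
  \<comment> \<open>Differences of consecutive values vanish since the values converge; divided by
    \<open>c\<close> they dominate the squared steps.\<close>
  have "(\<lambda>k. (\<phi> (x k) - \<phi> (x (Suc k))) / c) \<longlonglongrightarrow> (l - l) / c"
    using \<open>c > 0\<close> by (intro tendsto_intros l LIMSEQ_Suc[OF l]) simp
  then have "(\<lambda>k. (\<phi> (x k) - \<phi> (x (Suc k))) / c) \<longlonglongrightarrow> 0"
    by simp
  then have "(\<lambda>k. (norm (x (Suc k) - x k))\<^sup>2) \<longlonglongrightarrow> 0"
    by (rule Lim_null_comparison[rotated])
      (use descent in \<open>eventually_elim, use \<open>c > 0\<close> in \<open>simp add: field_simps\<close>\<close>)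
  then have "(\<lambda>k. x (Suc k) - x k) \<longlonglongrightarrow> 0"
    using tendsto_real_sqrt tendsto_norm_zero_iff by fastforce
  with g(1) \<open>g > 0\<close> l show thesis
    by (rule that)
qed

text \<open>The local Lipschitz constant bounds the subgradients, Bolzano-Weierstrass gives a limit,
  and the closed graph places it in the subdifferential at \<open>u\<close>.\<close>

lemma subdiff_subsequence:
  fixes \<phi> :: "'a::euclidean_space \<Rightarrow> real"
  assumes "S = limiting_subdiff \<or> S = clarke_subdiff" "e > 0" "L-lipschitz_on (ball u e) \<phi>"
    and xs: "xs \<longlonglongrightarrow> u" and vs: "\<And>k::nat. vs k \<in> S \<phi> (xs k)"
  obtains s v where "strict_mono s" "(vs \<circ> s) \<longlonglongrightarrow> v" "v \<in> S \<phi> u"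
proof -
  have "\<forall>\<^sub>F k in sequentially. xs k \<in> ball u e"
    using xs \<open>e > 0\<close> topological_tendstoD[of xs u _ "ball u e"] by simp
  then have "\<forall>\<^sub>F k in sequentially. norm (vs k) \<le> L"
    by eventually_elim
      (use assms(1,3) vs norm_limiting_subdiff_le norm_clarke_subdiff_le open_ball in metis)
  then have "bounded (range vs)"
    using Bfun_def Bseq_eq_bounded eventually_mono by (metis BfunI)
  then obtain s v where s: "strict_mono s" "(vs \<circ> s) \<longlonglongrightarrow> v"
    using bounded_imp_convergent_subsequence by blast
  have xs': "(\<lambda>k. xs (s k)) \<longlonglongrightarrow> u" and vs': "(\<lambda>k. vs (s k)) \<longlonglongrightarrow> v"
    using LIMSEQ_subseq_LIMSEQ[OF xs s(1)] s(2) by (auto simp: comp_def)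
  have "isCont \<phi> u"
    using lipschitz_on_continuous_on[OF assms(3)] \<open>e > 0\<close>
    by (simp add: continuous_on_eq_continuous_at)
  then have "(\<lambda>k. \<phi> (xs (s k))) \<longlonglongrightarrow> \<phi> u"
    using isCont_tendsto_compose xs' by blast
  then have "v \<in> S \<phi> u"
    using assms(1) limiting_subdiff_closed_graph[OF xs' _ vs'] clarke_subdiff_closed_graph[OF xs' vs'] vs
    by auto
  with s show thesis
    by (rule that)
qed

text \<open>The projection inclusion passes to the limit along \<open>r\<close>: the step sizes tend
  to the positive number \<open>1 / (2 * \<alpha> * g)\<close>, which becomes the
  \<open>\<tau>\<close> of the proximal normal.\<close>

lemma acpsm_accumulation_point:
  fixes x w :: "nat \<Rightarrow> 'a::euclidean_space"
  assumes "closed D" "gamma \<kappa> \<longlonglongrightarrow> g" "g > 0" "\<alpha> > 0" "(\<lambda>k. x (Suc k) - x k) \<longlonglongrightarrow> 0"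
    and proj: "\<And>k. x (Suc k) \<in> projection D (x k - stepsize \<alpha> \<kappa> k *\<^sub>R w k)"
    and r: "strict_mono r" "(x \<circ> r) \<longlonglongrightarrow> u" "(w \<circ> r) \<longlonglongrightarrow> v"
  shows "- v \<in> prox_normal_cone D u"
proof -
  have sub: "(\<lambda>k. x (r k)) \<longlonglongrightarrow> u" "(\<lambda>k. w (r k)) \<longlonglongrightarrow> v" "(\<lambda>k. gamma \<kappa> (r k)) \<longlonglongrightarrow> g"
    "(\<lambda>k. x (Suc (r k)) - x (r k)) \<longlonglongrightarrow> 0"
    using r LIMSEQ_subseq_LIMSEQ[OF assms(2) r(1)] LIMSEQ_subseq_LIMSEQ[OF assms(5) r(1)]
    by (auto simp: comp_def)
  have "(\<lambda>k. x (r k) - stepsize \<alpha> \<kappa> (r k) *\<^sub>R w (r k)) \<longlonglongrightarrow> u - (1 / (2 * \<alpha> * g)) *\<^sub>R v"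
    unfolding stepsize_def using assms by (intro tendsto_intros sub) auto
  \<comment> \<open>The successors need not belong to the subsequence, but vanishing steps give them
    the same limit.\<close>
  moreover have "(\<lambda>k. x (Suc (r k))) \<longlonglongrightarrow> u"
    using tendsto_add[OF sub(4,1)] by simp
  ultimately have "u \<in> projection D (u - (1 / (2 * \<alpha> * g)) *\<^sub>R v)"
    using projection_closed_graph[OF assms(1)] proj by blast
  then have "u \<in> projection D (u + (1 / (2 * \<alpha> * g)) *\<^sub>R (- v))"
    by simp
  moreover have "1 / (2 * \<alpha> * g) > 0"
    using assms by simp
  ultimately show ?thesis
    unfolding prox_normal_cone_def by blast
qed

theorem theorem4p6:
  fixes D :: "'a::euclidean_space set"
    and \<phi> :: "'a \<Rightarrow> real"
    and subdiff :: "('a \<Rightarrow> real) \<Rightarrow> 'a \<Rightarrow> 'a set"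
    and K \<alpha> :: real
    and crit :: "nat \<Rightarrow> bool"
    and x w :: "nat \<Rightarrow> 'a"
    and \<kappa> :: "nat \<Rightarrow> real"
  assumes "D \<noteq> {}" and "closed D"
    and "upper_C2_on TYPE('c) UNIV \<phi>"
    and "bdd_below (range \<phi>)"
    and "subdiff = limiting_subdiff \<or> subdiff = clarke_subdiff"
    and "K \<ge> 0"
    and "\<forall>u\<in>D. \<forall>y\<in>D. \<forall>v\<in>subdiff \<phi> u. \<phi> y \<le> \<phi> u + v \<bullet> (y - u) + K * (norm (y - u))\<^sup>2"
    and "acpsm_run (subdiff \<phi>) \<phi> D \<alpha> crit x w \<kappa>"
  shows "(\<exists>k. stops_at crit x k \<and> - w k \<in> prox_normal_cone D (x k)) \<or>
         (\<forall>k. \<not> stops_at crit x k) \<and>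
         (\<forall>xstar. (\<exists>r. strict_mono r \<and> (x \<circ> r) \<longlonglongrightarrow> xstar) \<longrightarrow>
            (\<exists>wstar\<in>subdiff \<phi> xstar. - wstar \<in> prox_normal_cone D xstar)) \<and>
         (\<forall>xstar. (\<exists>r. strict_mono r \<and> (x \<circ> r) \<longlonglongrightarrow> xstar) \<longrightarrow>
            (\<lambda>k. \<phi> (x k)) \<longlonglongrightarrow> \<phi> xstar)"
proof (cases "\<exists>k. stops_at crit x k")
  case True
  then show ?thesis
    using acpsm_run_stops[OF assms(8)] by blast
next
  case False
  then have never: "\<And>k. \<not> stops_at crit x k"
    by blast
  note run = acpsm_run_infinite[OF assms(8) never]
  obtain g l where g: "gamma \<kappa> \<longlonglongrightarrow> g" "g > 0" and l: "(\<lambda>k. \<phi> (x k)) \<longlonglongrightarrow> l"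
    and step: "(\<lambda>k. x (Suc k) - x k) \<longlonglongrightarrow> 0"
    using acpsm_run_limits[OF assms(8) never assms(4)] assms(7) by blast
  have "\<alpha> > 0"
    using assms(8) unfolding acpsm_run_def by auto
  have "(\<exists>wstar\<in>subdiff \<phi> xstar. - wstar \<in> prox_normal_cone D xstar) \<and>
      (\<lambda>k. \<phi> (x k)) \<longlonglongrightarrow> \<phi> xstar"
    if r: "strict_mono r" "(x \<circ> r) \<longlonglongrightarrow> xstar" for r xstar
  proof
    obtain e L where e: "e > 0" "L-lipschitz_on (ball xstar e) \<phi>"
      using upper_C2_on_locally_lipschitz[OF assms(3)] by blast
    \<comment> \<open>A further subsequence of \<open>r\<close>, along which the subgradients
      converge as well.\<close>
    obtain s v where s: "strict_mono s" "(w \<circ> r \<circ> s) \<longlonglongrightarrow> v" "v \<in> subdiff \<phi> xstar"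
      using subdiff_subsequence[OF assms(5) e r(2), of "w \<circ> r"] run(3) by auto
    have "- v \<in> prox_normal_cone D xstar"
    proof (rule acpsm_accumulation_point[OF assms(2) g \<open>\<alpha> > 0\<close> step run(4)])
      show "strict_mono (r \<circ> s)"
        using r(1) s(1) by (rule strict_mono_o)
      show "(x \<circ> (r \<circ> s)) \<longlonglongrightarrow> xstar"
        using LIMSEQ_subseq_LIMSEQ[OF r(2) s(1)] by (simp add: comp_assoc)
      show "(w \<circ> (r \<circ> s)) \<longlonglongrightarrow> v"
        using s(2) by (simp add: comp_assoc)
    qed
    with s(3) show "\<exists>wstar\<in>subdiff \<phi> xstar. - wstar \<in> prox_normal_cone D xstar"
      by blast
    have "isCont \<phi> xstar"
      using lipschitz_on_continuous_on[OF e(2)] e(1) by (simp add: continuous_on_eq_continuous_at)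
    then have "(\<lambda>k. \<phi> (x (r k))) \<longlonglongrightarrow> \<phi> xstar"
      using isCont_tendsto_compose r(2) by (fastforce simp: comp_def)
    \<comment> \<open>The full sequence of values already converges to \<open>l\<close>; the
      subsequence only identifies \<open>l\<close> as \<open>\<phi> xstar\<close>.\<close>
    moreover have "(\<lambda>k. \<phi> (x (r k))) \<longlonglongrightarrow> l"
      using LIMSEQ_subseq_LIMSEQ[OF l r(1)] by (simp add: comp_def)
    ultimately show "(\<lambda>k. \<phi> (x k)) \<longlonglongrightarrow> \<phi> xstar"
      using l LIMSEQ_unique by blast
  qed
  then show ?thesis
    using never by blast
qed

end
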